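(* Let $n \geq 0$. A path $w \in P(n,n)$ is idempotent (i.e. $w \otimes w = w$) if and only if it is an upper zigzag.
   Context: $P(n,m)$ denotes the set of words $w \in \{x,y\}^{*}$ with exactly $n$ occurrences of $x$ and $m$ occurrences of $y$; such a word is identified with the lattice path from $(0,0)$ to $(n,m)$ where $x$ is a unit East step and $y$ is a unit North step. Blocks: the $m$ occurrences of $y$ split $w\in P(n,m)$ into $m+1$ (possibly empty) words $\mathbf{bl}^{w,x}_0,\ldots,\mathbf{bl}^{w,x}_m \in \{x\}^{*}$ with $w = \mathbf{bl}^{w,x}_0 \, y\, \mathbf{bl}^{w,x}_1\, y \cdots y\, \mathbf{bl}^{w,x}_m$; similarly the $n$ occurrences of $x$ split $w$ into words $\mathbf{bl}^{w,y}_0,\ldots,\mathbf{bl}^{w,y}_n \in \{y\}^{*}$ with $w = \mathbf{bl}^{w,y}_0\, x\, \mathbf{bl}^{w,y}_1\, x\cdots x\, \mathbf{bl}^{w,y}_n$. Product: for $w \in P(n,m)$ and $u \in P(m,k)$, $w \otimes u := \mathbf{bl}^{w,x}_0\, \mathbf{bl}^{u,y}_0\, \mathbf{bl}^{w,x}_1\, \mathbf{bl}^{u,y}_1 \cdots \mathbf{bl}^{w,x}_m\, \mathbf{bl}^{u,y}_m \in P(n,k)$. Turns: if $w = w_0 w_1$ where $w_0$ ends with $y$ and $w_1$ begins with $x$, then $w$ has a North-East turn at the point $(a,b)$, where $a$ and $b$ are the numbers of $x$'s and $y$'s in $w_0$; if $w_0$ ends with $x$ and $w_1$ begins with $y$,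 then $w$ has an East-North turn at the point $(a,b)$, defined in the same way. A path is an upper zigzag if each of its North-East turns is above the line $y = x + \frac12$ and each of its East-North turns is below this line; equivalently, every North-East turn $(a,b)$ satisfies $a < b$ and every East-North turn $(a,b)$ satisfies $b \leq a$. *)

theory Defs
  imports Complex_Main
begin

(* East is the letter x and North is the letter y; a word is identified with its lattice path. *)
datatype step = East | North

definition paths :: "nat \<Rightarrow> nat \<Rightarrow> step list set" where
  "paths n m = {w. count_list w East = n \<and> count_list w North = m}"

fun split_at :: "'a \<Rightarrow> 'a list \<Rightarrow> 'a list list" where
  "split_at c [] = [[]]"
| "split_at c (a # w) =
    (if a = c then [] # split_at c w
     else (a # hd (split_at c w)) # tl (split_at c w))"

(* The x-blocks of a word are separated by its letters y, and vice versa.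
   Both lists are indexed from 0. *)
definition x_blocks :: "step list \<Rightarrow> step list list" where
  "x_blocks w = split_at North w"

definition y_blocks :: "step list \<Rightarrow> step list list" where
  "y_blocks w = split_at East w"

(* For w in paths n m and u in paths m k both block lists have length m + 1.
   For other arguments the longer list is truncated; such products have no meaning. *)
definition path_prod :: "step list \<Rightarrow> step list \<Rightarrow> step list" (infixl "\<otimes>" 70) where
  "w \<otimes> u = concat (map2 (@) (x_blocks w) (y_blocks u))"

definition NE_turn :: "step list \<Rightarrow> nat \<Rightarrow> nat \<Rightarrow> bool" where
  "NE_turn w a b \<longleftrightarrow>
    (\<exists>w0 w1. w = w0 @ w1 \<and> w0 \<noteq> [] \<and> last w0 = North \<and> w1 \<noteq> [] \<and> hd w1 = East \<and>
      a = count_list w0 East \<and> b = count_list w0 North)"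

definition EN_turn :: "step list \<Rightarrow> nat \<Rightarrow> nat \<Rightarrow> bool" where
  "EN_turn w a b \<longleftrightarrow>
    (\<exists>w0 w1. w = w0 @ w1 \<and> w0 \<noteq> [] \<and> last w0 = East \<and> w1 \<noteq> [] \<and> hd w1 = North \<and>
      a = count_list w0 East \<and> b = count_list w0 North)"

definition upper_zigzag :: "step list \<Rightarrow> bool" where
  "upper_zigzag w \<longleftrightarrow>
    (\<forall>a b. NE_turn w a b \<longrightarrow> real b > real a + 1/2) \<and>
    (\<forall>a b. EN_turn w a b \<longrightarrow> real b < real a + 1/2)"

lemma upper_zigzag_iff:
  "upper_zigzag w \<longleftrightarrow>
    (\<forall>a b. NE_turn w a b \<longrightarrow> a < b) \<and> (\<forall>a b. EN_turn w a b \<longrightarrow> b \<le> a)"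
proof -
  have "real b > real a + 1/2 \<longleftrightarrow> a < b" "real b < real a + 1/2 \<longleftrightarrow> b \<le> a" for a b :: nat
    by linarith+
  then show ?thesis by (simp add: upper_zigzag_def)
qed

lemma length_split_at: "length (split_at c w) = Suc (count_list w c)"
  by (induction w) auto

lemma split_at_nonempty: "split_at c w \<noteq> []"
  using length_split_at[of c w] by auto

lemma split_at_free: "v \<in> set (split_at c w) \<Longrightarrow> c \<notin> set v"
proof (induction w arbitrary: v)
  case Nil
  then show ?case by simp
next
  case (Cons a w)
  obtain b bs where "split_at c w = b # bs"
    using split_at_nonempty[of c w] by (cases "split_at c w") auto
  then show ?case using Cons by (auto split: if_splits)
qed

(* Inserting c in front of every block after the first recovers the word. *)
lemma split_at_join:
  "w = hd (split_at c w) @ concat (map ((#) c) (tl (split_at c w)))"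
proof (induction w)
  case Nil
  then show ?case by simp
next
  case (Cons a w)
  obtain b bs where "split_at c w = b # bs"
    using split_at_nonempty[of c w] by (cases "split_at c w") auto
  then show ?case using Cons by simp
qed

lemma length_x_blocks: "w \<in> paths n m \<Longrightarrow> length (x_blocks w) = m + 1"
  by (simp add: x_blocks_def paths_def length_split_at)

lemma length_y_blocks: "w \<in> paths n m \<Longrightarrow> length (y_blocks w) = n + 1"
  by (simp add: y_blocks_def paths_def length_split_at)

lemma count_concat_map2:
  "length us = length vs \<Longrightarrow>
    count_list (concat (map2 (@) us vs)) d = count_list (concat us) d + count_list (concat vs) d"
  by (induction us vs rule: list_induct2) auto

lemma count_concat_split_at:
  "count_list (concat (split_at c w)) d = (if d = c then 0 else count_list w d)"
proof (induction w)
  case Nil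
  then show ?case by simp
next
  case (Cons a w)
  obtain b bs where "split_at c w = b # bs"
    using split_at_nonempty[of c w] by (cases "split_at c w") auto
  then show ?case using Cons by auto
qed

lemma path_prod_in_paths:
  assumes "w \<in> paths n m" and "u \<in> paths m k"
  shows "w \<otimes> u \<in> paths n k"
proof -
  have "length (x_blocks w) = length (y_blocks u)"
    using assms by (simp add: length_x_blocks length_y_blocks)
  then show ?thesis
    using assms
    by (simp add: path_prod_def paths_def count_concat_map2)
       (simp add: x_blocks_def y_blocks_def count_concat_split_at)
qed

end

(* Let f j be the number of North steps before the j-th East step, with f 0 = 0.
   A path is determined by the monotone function f, and the product of paths becomes the
   composition of these functions.  Turns are the jumps of f, and the zigzag condition says
   that every level set of f contains its own value v, that is f v = v. *)
theory Submission
  imports Defs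
begin

(* The arguments j are counted from 1, with the convention height w 0 = 0. If j exceeds the
   number of East steps, the value is the total number of North steps. *)
fun height :: "step list \<Rightarrow> nat \<Rightarrow> nat" where
  "height [] j = 0"
| "height (s # w) 0 = 0"
| "height (East # w) (Suc j) = height w j"
| "height (North # w) (Suc j) = Suc (height w (Suc j))"

lemma height_0 [simp]: "height w 0 = 0"
  by (cases w) auto

lemma height_le_count: "height w j \<le> count_list w North"
  by (induction w j rule: height.induct) auto

lemma height_beyond: "count_list w East < j \<Longrightarrow> height w j = count_list w North"
  by (induction w j rule: height.induct) auto

text \<open>The case \<open>j = count_list w East\<close> belongs to the first branch: the North
  steps of \<open>w\<close> behind its last East step are not counted yet.\<close>

lemma height_append:
  "height (w @ u) j =
    (if j \<le> count_list w East then height w j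
     else count_list w North + height u (j - count_list w East))"
  by (induction w j rule: height.induct) auto

lemma height_mono: "i \<le> j \<Longrightarrow> height w i \<le> height w j"
proof (induction w j arbitrary: i rule: height.induct)
  case (3 w j)
  then show ?case by (cases i) auto
next
  case (4 w j)
  then show ?case by (cases i) auto
qed auto

text \<open>The value at 1 is positive exactly when the word starts with \<open>North\<close>, so
  the words agree letter by letter. The East counts separate words such as \<open>[]\<close> and
  \<open>[East]\<close>, whose heights both vanish.\<close>

lemma height_inject:
  assumes "\<And>j. height w j = height u j" "count_list w East = count_list u East"
  shows "w = u"
  using assms
proof (induction w arbitrary: u)
  case Nil
  show ?case
  proof (cases u)
    case (Cons s u')
    then show ?thesis using Nil.prems(1)[of "Suc 0"] Nil.prems(2) by (cases s) auto
  qed simp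
next
  case (Cons s w)
  show ?case
  proof (cases u)
    case Nil
    then show ?thesis using Cons.prems(1)[of "Suc 0"] Cons.prems(2) by (cases s) auto
  next
    case u: (Cons t v)
    have "s = t"
      using Cons.prems(1)[of "Suc 0"] u by (cases s; cases t) auto
    moreover have "height w j = height v j" for j
      using Cons.prems(1)[of "Suc j"] Cons.prems(1)[of j] u \<open>s = t\<close>
      by (cases s; cases j) auto
    moreover have "count_list w East = count_list v East"
      using Cons.prems(2) u \<open>s = t\<close> by (cases s) auto
    ultimately show ?thesis using Cons.IH u by blast
  qed
qed

section \<open>The product as composition of heights\<close>

text \<open>This rule and the next two read the product off the first letters: East steps of
  \<open>w\<close> and North steps of \<open>u\<close> are output, while a North of \<open>w\<close>
  and an East of \<open>u\<close> are block separators and cancel.\<close>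

lemma path_prod_East: "(East # w) \<otimes> u = East # (w \<otimes> u)"
  using split_at_nonempty[of North w] split_at_nonempty[of East u]
  by (cases "split_at North w"; cases "split_at East u")
     (auto simp: path_prod_def x_blocks_def y_blocks_def)

lemma path_prod_North_North: "(North # w) \<otimes> (North # u) = North # ((North # w) \<otimes> u)"
  using split_at_nonempty[of East u]
  by (cases "split_at East u") (auto simp: path_prod_def x_blocks_def y_blocks_def)

lemma path_prod_North_East: "(North # w) \<otimes> (East # u) = w \<otimes> u"
  by (simp add: path_prod_def x_blocks_def y_blocks_def)

text \<open>The \<open>j\<close>-th East step of \<open>w\<close> lies in its x-block number
  \<open>height w j\<close>. The y-blocks of \<open>u\<close> placed before it are those before East
  step number \<open>height w j\<close> of \<open>u\<close>.\<close>

lemma height_path_prod: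
  assumes "count_list w North \<le> count_list u East" "j \<le> count_list w East"
  shows "height (w \<otimes> u) j = height u (height w j)"
  using assms
proof (induction "length w + length u" arbitrary: w u j rule: less_induct)
  case less
  show ?case
  proof (cases j)
    case (Suc i)
    show ?thesis
    proof (cases w)
      case Nil
      then show ?thesis using less.prems Suc by simp
    next
      case w: (Cons s w')
      show ?thesis
      proof (cases s)
        case East
        then show ?thesis using less.prems less.hyps[of w' u i] w Suc
          by (simp add: path_prod_East)
      next
        case North
        show ?thesis
        proof (cases u)
          case Nil
          then show ?thesis using less.prems w North by simp
        next
          case u: (Cons t u')
          show ?thesis
          proof (cases t)
            case East
            then show ?thesis using less.prems less.hyps[of w' u' j] w u North Suc
              by (simp add: path_prod_North_East)
          next
            case t: North
            then show ?thesis using less.prems less.hyps[of w u' j] w u North Suc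
              by (simp add: path_prod_North_North)
          qed
        qed
      qed
    qed
  qed simp
qed

lemma idempotent_iff_height:
  assumes "w \<in> paths n n"
  shows "w \<otimes> w = w \<longleftrightarrow> (\<forall>j\<le>n. height w (height w j) = height w j)"
proof
  assume "w \<otimes> w = w"
  then show "\<forall>j\<le>n. height w (height w j) = height w j"
    using height_path_prod[of w w] assms by (auto simp: paths_def)
next
  assume idem: "\<forall>j\<le>n. height w (height w j) = height w j"
  have prod: "w \<otimes> w \<in> paths n n" using path_prod_in_paths[OF assms assms] .
  have "height (w \<otimes> w) j = height w j" for j
  proof (cases "j \<le> n")
    case True
    then show ?thesis using idem height_path_prod[of w w j] assms by (simp add: paths_def)
  next
    case False
    \<comment> \<open>Past the last East step both heights equal the number \<open>n\<close> of
      North steps.\<close>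
    then show ?thesis using prod assms by (simp add: paths_def height_beyond)
  qed
  then show "w \<otimes> w = w" using prod assms by (intro height_inject) (auto simp: paths_def)
qed

section \<open>Turns as jumps of the height\<close>

lemma split_before_East:
  "a < count_list w East \<Longrightarrow> \<exists>w0 w1. w = w0 @ East # w1 \<and> count_list w0 East = a"
proof (induction w arbitrary: a)
  case (Cons s w)
  show ?case
  proof (cases s)
    case East
    show ?thesis
    proof (cases a)
      case 0
      then show ?thesis using East by force
    next
      case (Suc i)
      then obtain w0 w1 where "w = w0 @ East # w1" "count_list w0 East = i"
        using Cons East by fastforce
      then have "s # w = (East # w0) @ East # w1" "count_list (East # w0) East = a"
        using East Suc by auto
      then show ?thesis by blast
    qed
  next
    case North
    then obtain w0 w1 where "w = w0 @ East # w1" "count_list w0 East = a"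
      using Cons by fastforce
    then have "s # w = (North # w0) @ East # w1" "count_list (North # w0) East = a"
      using North by auto
    then show ?thesis by blast
  qed
qed simp

text \<open>The turn sits just before East step number \<open>Suc a\<close>, and some North step
  lies between it and East step number \<open>a\<close> (or the start, if
  \<open>a = 0\<close>).\<close>

lemma NE_turn_iff_height:
  "NE_turn w a b \<longleftrightarrow> a < count_list w East \<and> height w a < b \<and> b = height w (Suc a)"
proof
  assume "NE_turn w a b"
  then obtain w0 w1 where w: "w = w0 @ w1" "w0 \<noteq> []" "last w0 = North" "w1 \<noteq> []" "hd w1 = East"
    and ab: "a = count_list w0 East" "b = count_list w0 North"
    unfolding NE_turn_def by blast
  obtain v where v: "w0 = v @ [North]" using w by (metis append_butlast_last_id)
  obtain z where "w1 = East # z" using w by (cases w1) auto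
  then show "a < count_list w East \<and> height w a < b \<and> b = height w (Suc a)"
    using w(1) ab v height_le_count[of v a] by (simp add: height_append)
next
  assume a: "a < count_list w East \<and> height w a < b \<and> b = height w (Suc a)"
  then obtain w0 w1 where w: "w = w0 @ East # w1" "count_list w0 East = a"
    using split_before_East by blast
  then have b: "b = count_list w0 North" "height w0 a < b"
    using a by (simp_all add: height_append)
  then have "w0 \<noteq> []" by auto
  moreover have "last w0 = North"
  proof (rule ccontr)
    \<comment> \<open>A final East of \<open>w0\<close> would be its \<open>a\<close>-th one, with
      all North steps of \<open>w0\<close> before it, forcing
      \<open>height w0 a = b\<close>.\<close>
    assume "last w0 \<noteq> North"
    then have "last w0 = East" by (cases "last w0") auto
    then obtain v where "w0 = v @ [East]" using \<open>w0 \<noteq> []\<close> by (metis append_butlast_last_id)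
    then show False using b w(2) by (auto simp: height_append)
  qed
  ultimately show "NE_turn w a b"
    unfolding NE_turn_def using w b by (intro exI[of _ w0] exI[of _ "East # w1"]) auto
qed

text \<open>The turn sits just after East step number \<open>a\<close>. For
  \<open>a = count_list w East\<close> the value at \<open>Suc a\<close> is the total number of
  North steps, so final North steps also make a jump.\<close>

lemma EN_turn_iff_height:
  "EN_turn w a b \<longleftrightarrow>
    0 < a \<and> a \<le> count_list w East \<and> b = height w a \<and> b < height w (Suc a)"
proof
  assume "EN_turn w a b"
  then obtain w0 w1 where w: "w = w0 @ w1" "w0 \<noteq> []" "last w0 = East" "w1 \<noteq> []" "hd w1 = North"
    and ab: "a = count_list w0 East" "b = count_list w0 North"
    unfolding EN_turn_def by blast
  obtain v where v: "w0 = v @ [East]" using w by (metis append_butlast_last_id)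
  obtain z where "w1 = North # z" using w by (cases w1) auto
  then show "0 < a \<and> a \<le> count_list w East \<and> b = height w a \<and> b < height w (Suc a)"
    using w(1) ab v by (simp add: height_append numeral_2_eq_2)
next
  assume a: "0 < a \<and> a \<le> count_list w East \<and> b = height w a \<and> b < height w (Suc a)"
  then obtain i where i: "a = Suc i" "i < count_list w East" by (cases a) auto
  then obtain v w1 where w: "w = v @ East # w1" "count_list v East = i"
    using split_before_East by blast
  have b: "b = count_list v North" and "0 < height w1 (Suc 0)"
    using a w i by (auto simp: height_append numeral_2_eq_2)
  then obtain z where "w1 = North # z" by (cases "(w1, Suc 0)" rule: height.cases) auto
  then show "EN_turn w a b"
    unfolding EN_turn_def using w a b i
    by (intro exI[of _ "v @ [East]"] exI[of _ w1]) auto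
qed

lemma upper_zigzag_iff_height:
  assumes "w \<in> paths n m"
  shows "upper_zigzag w \<longleftrightarrow>
    (\<forall>a<n. height w a < height w (Suc a) \<longrightarrow> a < height w (Suc a)) \<and>
    (\<forall>a\<le>n. height w a < height w (Suc a) \<longrightarrow> height w a \<le> a)"
proof -
  have "0 < a \<or> height w a \<le> a" for a by (cases a) auto
  then show ?thesis
    using assms unfolding upper_zigzag_iff NE_turn_iff_height EN_turn_iff_height paths_def
    by auto
qed

section \<open>Idempotent monotone functions and their jumps\<close>

theorem theorem2:
  fixes n :: nat and w :: "step list"
  assumes "w \<in> paths n n"
  shows "w \<otimes> w = w \<longleftrightarrow> upper_zigzag w"
proof -
  let ?f = "height w"
  have le_n: "?f j \<le> n" for j
    using height_le_count[of w j] assms by (simp add: paths_def)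
  have last: "?f (Suc n) = n"
    using assms by (simp add: paths_def height_beyond)
  show ?thesis
    unfolding idempotent_iff_height[OF assms] upper_zigzag_iff_height[OF assms]
  proof (intro iffI conjI allI impI)
    fix a assume idem: "\<forall>j\<le>n. ?f (?f j) = ?f j" and "a < n" and jump: "?f a < ?f (Suc a)"
    then have "?f (?f (Suc a)) = ?f (Suc a)" by auto
    \<comment> \<open>Otherwise \<open>?f (Suc a) \<le> a\<close>, and applying \<open>?f\<close>
      gives \<open>?f (Suc a) \<le> ?f a\<close>.\<close>
    then show "a < ?f (Suc a)"
      using jump height_mono[of "?f (Suc a)" a w] by linarith
  next
    fix a assume idem: "\<forall>j\<le>n. ?f (?f j) = ?f j" and "a \<le> n" and jump: "?f a < ?f (Suc a)"
    then have "?f (?f a) = ?f a" by auto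
    \<comment> \<open>Otherwise \<open>Suc a \<le> ?f a\<close>, and applying \<open>?f\<close>
      gives \<open>?f (Suc a) \<le> ?f a\<close>.\<close>
    then show "?f a \<le> a"
      using jump height_mono[of "Suc a" "?f a" w] by linarith
  next
    fix j
    assume zz: "(\<forall>a<n. ?f a < ?f (Suc a) \<longrightarrow> a < ?f (Suc a)) \<and>
      (\<forall>a\<le>n. ?f a < ?f (Suc a) \<longrightarrow> ?f a \<le> a)" and j: "j \<le> n"
    define v where "v = ?f j"
    have "?f v \<le> v"
    proof (rule ccontr)
      assume less: "\<not> ?f v \<le> v"
      \<comment> \<open>The right end of the level set of \<open>v\<close> up to \<open>n\<close>:
        the jump after it gives \<open>v \<le> t\<close>, hence
        \<open>?f v \<le> ?f t = v\<close>.\<close>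
      define t where "t = Max {i. i \<le> n \<and> ?f i = v}"
      have fin: "finite {i. i \<le> n \<and> ?f i = v}" by simp
      have "t \<in> {i. i \<le> n \<and> ?f i = v}"
        unfolding t_def using Max_in[OF fin] j v_def by blast
      then have t: "t \<le> n" "?f t = v" by auto
      have "?f t < ?f (Suc t)"
      proof (cases "t = n")
        case True
        \<comment> \<open>Here \<open>v < ?f v \<le> n\<close>, while
          \<open>?f (Suc n) = n\<close>.\<close>
        then show ?thesis using last t less le_n[of v] le_n[of j] v_def by auto
      next
        case False
        then have "?f (Suc t) \<noteq> v"
          using Max_ge[OF fin, of "Suc t"] t(1) unfolding t_def[symmetric] by auto
        then show ?thesis using height_mono[of t "Suc t" w] t(2) by auto
      qed
      then have "v \<le> t" using zz t by auto
      then show False using height_mono[of v t w] t less by simp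
    qed
    moreover have "v \<le> ?f v"
    proof -
      \<comment> \<open>The left end of the same level set: unless \<open>s = 0\<close>, the jump
        into \<open>s\<close> gives \<open>s \<le> v\<close>, hence
        \<open>v = ?f s \<le> ?f v\<close>.\<close>
      define s where "s = (LEAST i. ?f i = v)"
      have s: "?f s = v" "s \<le> j"
        unfolding s_def using v_def by (auto intro: LeastI Least_le)
      have "s \<le> v"
      proof (cases s)
        case (Suc r)
        then have "?f r \<noteq> v" using not_less_Least[of r "\<lambda>i. ?f i = v"] s_def by auto
        then have "?f r < ?f (Suc r)" using height_mono[of r s w] s Suc by auto
        then have "r < ?f (Suc r)" using zz Suc s j by auto
        then show ?thesis using Suc s by simp
      qed simp
      then show ?thesis using height_mono[of s v w] s by simp
    qed
    ultimately show "?f (?f j) = ?f j" using v_def by simp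
  qed
qed

end
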